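(* Let $(X,d,\mu)$ be a coarse median space and $n\in\mathbb N$. The following are equivalent: (1) $X$ has rank at most $n$; (2) for every $\lambda>0$ there is a constant $C=C(\lambda)$ such that for all $a,b\in X$ and all $e_1,\ldots,e_{n+1}\in[a,b]$ with $\mu(e_i,a,e_j)\sim_\lambda a$ for all $i\neq j$, there exists $i$ with $e_i\sim_C a$; (3) for every $L>0$ there is a constant $C=C(L)$ such that for every $L$-quasi-morphism $\sigma\colon I^{n+1}\to X$ there exist adjacent points $x,y\in I^{n+1}$ with $\sigma(x)\sim_C\sigma(y)$.
   Context: Write $x\sim_s y$ if $d(x,y)\leqslant s$. A coarse median space is a triple $(X,d,\mu)$ with $(X,d)$ a metric space and $\mu\colon X^3\to X$ satisfying: (M1) $\mu(a,a,b)=a$; (M2) $\mu(a_1,a_2,a_3)$ is invariant under permutations of its arguments; (C1) there is an affine $\rho(t)=Kt+H_0$ with $d(\mu(a,b,c),\mu(a',b',c'))\leqslant\rho(d(a,a')+d(b,b')+d(c,c'))$ for all points; (C2) there is $H\colon\mathbb N\to[0,\infty)$ such that for every finite $A\subseteq X$ with $1\leqslant|A|\leqslant p$ there are a finite median algebra $(\Pi,\mu_\Pi)$ and maps $\pi\colon A\to\Pi$, $\lambda\colon\Pi\to X$ with $\lambda\mu_\Pi(x,y,z)\sim_{H(p)}\mu(\lambda x,\lambda y,\lambda z)$ for all $x,y,z\in\Pi$ and $\lambda\pi a\sim_{H(p)}a$ for all $a\in A$. (A median algebra is a set with a ternary operation $m$ satisfying $m(a,a,b)=a$, full symmetry, and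 $m(m(a,b,c),b,d)=m(a,b,m(c,b,d))$.) The median cube $I^k$ is $(\mathbb Z_2)^k$ with median $\mu_k$ given by coordinatewise majority vote; two points of $I^k$ are adjacent if they differ in exactly one coordinate. The rank of a median algebra is the supremum of $k$ such that it contains a subalgebra isomorphic to $I^k$. The coarse median space has rank at most $n$ if there exist $\rho,H$ as in (C1),(C2) for which $\Pi$ in (C2) can always be chosen of rank at most $n$. The interval is $[a,b]=\{\mu(a,y,b):y\in X\}$. A map $\sigma\colon I^k\to X$ is an $L$-quasi-morphism if $\mu(\sigma x,\sigma y,\sigma z)\sim_L\sigma(\mu_k(x,y,z))$ for all $x,y,z\in I^k$. *)

theory Defs
  imports "HOL-Analysis.Analysis"
begin

definition median_algebra :: "'p set \<Rightarrow> ('p \<Rightarrow> 'p \<Rightarrow> 'p \<Rightarrow> 'p) \<Rightarrow> bool" where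
  "median_algebra P m \<longleftrightarrow>
     (\<forall>a\<in>P. \<forall>b\<in>P. \<forall>c\<in>P. m a b c \<in> P) \<and>
     (\<forall>a\<in>P. \<forall>b\<in>P. m a a b = a) \<and>
     (\<forall>a\<in>P. \<forall>b\<in>P. \<forall>c\<in>P. m a b c = m b a c \<and> m a b c = m a c b) \<and>
     (\<forall>a\<in>P. \<forall>b\<in>P. \<forall>c\<in>P. \<forall>d\<in>P. m (m a b c) b d = m a b (m c b d))"

definition cube :: "nat \<Rightarrow> bool list set" where
  "cube k = {xs. length xs = k}"

definition maj :: "bool \<Rightarrow> bool \<Rightarrow> bool \<Rightarrow> bool" where
  "maj a b c = ((a \<and> b) \<or> (b \<and> c) \<or> (a \<and> c))"

definition cube_median :: "bool list \<Rightarrow> bool list \<Rightarrow> bool list \<Rightarrow> bool list" where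
  "cube_median xs ys zs = map (\<lambda>((a, b), c). maj a b c) (zip (zip xs ys) zs)"

definition cube_adjacent :: "nat \<Rightarrow> bool list \<Rightarrow> bool list \<Rightarrow> bool" where
  "cube_adjacent k xs ys \<longleftrightarrow> xs \<in> cube k \<and> ys \<in> cube k \<and>
     card {i. i < k \<and> xs ! i \<noteq> ys ! i} = 1"

text \<open>P contains a subalgebra isomorphic to I^k: an injective median homomorphism
  from I^k into P (its image is then a subalgebra isomorphic to I^k).\<close>

definition has_cube_subalgebra :: "'p set \<Rightarrow> ('p \<Rightarrow> 'p \<Rightarrow> 'p \<Rightarrow> 'p) \<Rightarrow> nat \<Rightarrow> bool" where
  "has_cube_subalgebra P m k \<longleftrightarrow>
     (\<exists>f. f ` cube k \<subseteq> P \<and> inj_on f (cube k) \<and>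
          (\<forall>x\<in>cube k. \<forall>y\<in>cube k. \<forall>z\<in>cube k.
              f (cube_median x y z) = m (f x) (f y) (f z)))"

definition median_rank_le :: "'p set \<Rightarrow> ('p \<Rightarrow> 'p \<Rightarrow> 'p \<Rightarrow> 'p) \<Rightarrow> nat \<Rightarrow> bool" where
  "median_rank_le P m n \<longleftrightarrow> (\<forall>k. has_cube_subalgebra P m k \<longrightarrow> k \<le> n)"

definition close :: "'a::metric_space \<Rightarrow> real \<Rightarrow> 'a \<Rightarrow> bool" where
  "close x s y \<longleftrightarrow> dist x y \<le> s"

definition cm_C1 :: "('a::metric_space \<Rightarrow> 'a \<Rightarrow> 'a \<Rightarrow> 'a) \<Rightarrow> real \<Rightarrow> real \<Rightarrow> bool" where
  "cm_C1 mu K H0 \<longleftrightarrow>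
     (\<forall>a b c a' b' c'. dist (mu a b c) (mu a' b' c')
        \<le> K * (dist a a' + dist b b' + dist c c') + H0)"

text \<open>(C2), optionally with a rank bound on the approximating finite median algebras.
  Finite median algebras are represented on finite subsets of nat (every finite
  median algebra is isomorphic to one of these).\<close>

definition cm_C2 :: "('a::metric_space \<Rightarrow> 'a \<Rightarrow> 'a \<Rightarrow> 'a) \<Rightarrow> (nat \<Rightarrow> real) \<Rightarrow> nat option \<Rightarrow> bool" where
  "cm_C2 mu H r \<longleftrightarrow> (\<forall>p. H p \<ge> 0) \<and>
     (\<forall>p. \<forall>A::'a set. finite A \<and> 1 \<le> card A \<and> card A \<le> p \<longrightarrow>
        (\<exists>(P::nat set) mP (pi::'a \<Rightarrow> nat) (lam::nat \<Rightarrow> 'a).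
           finite P \<and> median_algebra P mP \<and>
           (case r of None \<Rightarrow> True | Some n \<Rightarrow> median_rank_le P mP n) \<and>
           pi ` A \<subseteq> P \<and>
           (\<forall>x\<in>P. \<forall>y\<in>P. \<forall>z\<in>P. close (lam (mP x y z)) (H p) (mu (lam x) (lam y) (lam z))) \<and>
           (\<forall>a\<in>A. close (lam (pi a)) (H p) a)))"

definition coarse_median :: "('a::metric_space \<Rightarrow> 'a \<Rightarrow> 'a \<Rightarrow> 'a) \<Rightarrow> bool" where
  "coarse_median mu \<longleftrightarrow>
     (\<forall>a b. mu a a b = a) \<and>
     (\<forall>a b c. mu a b c = mu b a c \<and> mu a b c = mu a c b) \<and>
     (\<exists>K H0 H. cm_C1 mu K H0 \<and> cm_C2 mu H None)"

definition coarse_median_rank_le :: "('a::metric_space \<Rightarrow> 'a \<Rightarrow> 'a \<Rightarrow> 'a) \<Rightarrow> nat \<Rightarrow> bool" where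
  "coarse_median_rank_le mu n \<longleftrightarrow>
     coarse_median mu \<and> (\<exists>K H0 H. cm_C1 mu K H0 \<and> cm_C2 mu H (Some n))"

definition cm_interval :: "('a \<Rightarrow> 'a \<Rightarrow> 'a \<Rightarrow> 'a) \<Rightarrow> 'a \<Rightarrow> 'a \<Rightarrow> 'a set" where
  "cm_interval mu a b = {mu a y b | y. True}"

definition quasi_morphism :: "('a::metric_space \<Rightarrow> 'a \<Rightarrow> 'a \<Rightarrow> 'a) \<Rightarrow> real \<Rightarrow> nat \<Rightarrow> (bool list \<Rightarrow> 'a) \<Rightarrow> bool" where
  "quasi_morphism mu L k sg \<longleftrightarrow>
     (\<forall>x\<in>cube k. \<forall>y\<in>cube k. \<forall>z\<in>cube k.
        close (mu (sg x) (sg y) (sg z)) L (sg (cube_median x y z)))"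

end

theory Submission
  imports Defs
begin

text \<open>
  In a median algebra the projection x \<mapsto> m a b x to an interval is a homomorphism. Hence in
  a finite one, homomorphisms to the two-point algebra (halfspaces) separate points, and
  median identities can be checked in bool.

  If X has rank at most n, approximate a, b and the given points of [a, b] by a finite median
  algebra of rank at most n. Replacing a by the join z of all the pairwise meets moves
  images by a bounded amount and makes the points genuinely disjoint over z; if none of them
  were below z, they would span an (n+1)-cube. The cube condition follows by looking at the
  corner 0 of a quasi-morphism and its neighbours. Conversely, restrict the approximating
  algebra to the subalgebra generated by A, which has at most 2^(2^p) points. As long as it
  contains an (n+1)-cube, the cube condition yields distinct x, y with close images. Identify all
  points separated only by halfspaces that separate x from y: u and v are then both
  between m u v x and m u v y, so points that are identified have close images.
\<close>

section \<open>Median algebras: betweenness and projections to intervals\<close>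

locale median_alg =
  fixes P :: "'p set" and m :: "'p \<Rightarrow> 'p \<Rightarrow> 'p \<Rightarrow> 'p"
  assumes median: "median_algebra P m"
begin

lemma closed [simp, intro]: "a \<in> P \<Longrightarrow> b \<in> P \<Longrightarrow> c \<in> P \<Longrightarrow> m a b c \<in> P"
  using median by (simp add: median_algebra_def)

lemma idem [simp]: "a \<in> P \<Longrightarrow> b \<in> P \<Longrightarrow> m a a b = a"
  using median by (simp add: median_algebra_def)

lemma swap12: "a \<in> P \<Longrightarrow> b \<in> P \<Longrightarrow> c \<in> P \<Longrightarrow> m a b c = m b a c"
  using median unfolding median_algebra_def by blast

lemma swap23: "a \<in> P \<Longrightarrow> b \<in> P \<Longrightarrow> c \<in> P \<Longrightarrow> m a b c = m a c b"
  using median unfolding median_algebra_def by blast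

lemma assoc:
  "a \<in> P \<Longrightarrow> b \<in> P \<Longrightarrow> c \<in> P \<Longrightarrow> d \<in> P \<Longrightarrow> m (m a b c) b d = m a b (m c b d)"
  using median unfolding median_algebra_def by blast

lemma idem_right [simp]: "a \<in> P \<Longrightarrow> b \<in> P \<Longrightarrow> m b a a = a"
  by (metis idem swap12 swap23)

lemma idem_outer [simp]: "a \<in> P \<Longrightarrow> b \<in> P \<Longrightarrow> m a b a = a"
  by (metis idem swap23)

text \<open>By \<open>btw_median\<close>, the fixed points of \<open>m a _ b\<close> are all of its
  values, so this is membership in the interval from \<open>a\<close> to \<open>b\<close>.\<close>

definition btw :: "'p \<Rightarrow> 'p \<Rightarrow> 'p \<Rightarrow> bool" where
  "btw a t b \<longleftrightarrow> m a t b = t"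

lemma btw_sym: "btw a t b \<Longrightarrow> a \<in> P \<Longrightarrow> t \<in> P \<Longrightarrow> b \<in> P \<Longrightarrow> btw b t a"
  by (metis btw_def swap12 swap23)

lemma btw_median:
  assumes "a \<in> P" "b \<in> P" "c \<in> P"
  shows "btw a (m a b c) b" "btw a (m a b c) c" "btw b (m a b c) c"
proof -
  have *: "btw a (m a b c) b" if "a \<in> P" "b \<in> P" "c \<in> P" for a b c
    using assoc[of c b a a] that unfolding btw_def by (simp add: swap12 swap23)
  show "btw a (m a b c) b" "btw a (m a b c) c" "btw b (m a b c) c"
    using *[of a b c] *[of a c b] *[of b c a] assms by (simp_all add: swap12 swap23)
qed

text \<open>For a fixed base point a, the relation btw a is a meet semilattice order on P with
  bottom a and meet m a.\<close>

lemma btw_trans: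
  "btw a d c \<Longrightarrow> btw a c b \<Longrightarrow> a \<in> P \<Longrightarrow> b \<in> P \<Longrightarrow> c \<in> P \<Longrightarrow> d \<in> P \<Longrightarrow> btw a d b"
  using assoc[of d a c b] unfolding btw_def by (simp add: swap12 swap23)

lemma btw_mid:
  "btw a d c \<Longrightarrow> btw a c b \<Longrightarrow> a \<in> P \<Longrightarrow> b \<in> P \<Longrightarrow> c \<in> P \<Longrightarrow> d \<in> P \<Longrightarrow> btw d c b"
  using assoc[of b c a d] unfolding btw_def by (simp add: swap12 swap23)

lemma btw_glb:
  "btw a t x \<Longrightarrow> btw a t y \<Longrightarrow> a \<in> P \<Longrightarrow> t \<in> P \<Longrightarrow> x \<in> P \<Longrightarrow> y \<in> P \<Longrightarrow> btw a t (m a x y)"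
  using assoc[of t a x y] unfolding btw_def by (simp add: swap12 swap23)

lemma btw_antisym:
  "btw a x y \<Longrightarrow> btw a y x \<Longrightarrow> a \<in> P \<Longrightarrow> x \<in> P \<Longrightarrow> y \<in> P \<Longrightarrow> x = y"
  unfolding btw_def by (metis swap23)

text \<open>With \<open>t = m a b c\<close>, greatest lower bounds put \<open>w\<close> below
  \<open>t\<close> over both \<open>a\<close> and \<open>b\<close>. As \<open>t\<close> lies between
  \<open>a\<close> and \<open>b\<close>, the relation over \<open>a\<close> turns around to
  \<open>btw b t w\<close>, and antisymmetry applies.\<close>

lemma median_unique:
  assumes "btw a w b" "btw b w c" "btw a w c" and P: "a \<in> P" "b \<in> P" "c \<in> P" "w \<in> P"
  shows "w = m a b c"
proof -
  define t where "t = m a b c"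
  have t: "t \<in> P" "t = m b a c" "t = m c a b"
    using P unfolding t_def by (metis closed swap12 swap23)+
  have "btw a w t" "btw b w t"
    using btw_glb[of a w b c] btw_glb[of b w a c] assms t t_def btw_sym[of a w b] by auto
  moreover have "btw a t b"
    using P btw_median(1) t_def by simp
  ultimately have "btw b t w"
    using btw_mid[of a w t b] btw_sym[of w t b] t P by simp
  then show ?thesis
    using btw_antisym[of b w t] \<open>btw b w t\<close> P t t_def by auto
qed

text \<open>Over the base \<open>x\<close>, the point \<open>m a x t\<close> lies below
  \<open>a\<close> and \<open>y\<close>, hence below \<open>m a x y\<close>. Turned around to the
  base \<open>a\<close>, this puts \<open>m a x y\<close> below \<open>m a x t\<close>, which is
  below \<open>t\<close>.\<close>

lemma btw_meet:
  assumes "btw x t y" and P: "a \<in> P" "x \<in> P" "y \<in> P" "t \<in> P"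
  shows "btw a (m a x y) t"
proof -
  have half: "btw a (m a x y) (m a x t)"
    if t: "btw x t y" and P: "x \<in> P" "y \<in> P" for x y
  proof -
    define p where "p = m a x y"
    define u where "u = m a x t"
    have mem: "p \<in> P" "u \<in> P"
      using \<open>a \<in> P\<close> \<open>t \<in> P\<close> P unfolding p_def u_def by auto
    have p: "m x a y = p"
      using \<open>a \<in> P\<close> P swap12 unfolding p_def by blast
    have "btw x u t" "btw a u x" "btw a p x"
      using \<open>a \<in> P\<close> \<open>t \<in> P\<close> P unfolding p_def u_def by (intro btw_median; simp)+
    then have u: "btw x u t" "btw x u a" "btw x p a"
      using btw_sym \<open>a \<in> P\<close> P mem by blast+
    then have "btw x u y"
      using btw_trans[of x u t y] t P mem \<open>t \<in> P\<close> by blast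
    then have "btw x u p"
      using btw_glb[of x u a y] u mem P p \<open>a \<in> P\<close> by simp
    then have "btw u p a"
      using btw_mid[of x u p a] u P mem \<open>a \<in> P\<close> by blast
    then show ?thesis
      using btw_sym[of u p a] mem \<open>a \<in> P\<close> unfolding p_def u_def by simp
  qed
  have "btw a (m a x t) t"
    using btw_median(2) P by simp
  then show ?thesis
    using half[OF assms(1)] btw_trans[of a "m a x y" "m a x t" t] P by simp
qed

text \<open>\<open>t\<close> lies between its meets \<open>u\<close> and \<open>v\<close> with
  \<open>x\<close> and \<open>y\<close>, and its projection \<open>r\<close> lies between
  \<open>t\<close> and each of them. Seen from \<open>t\<close>, \<open>r\<close> is then at most
  \<open>m t u v = t\<close>, the bottom, so \<open>r = t\<close>.\<close>

lemma interval_convex: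
  assumes "btw a x b" "btw a y b" "btw x t y"
    and P: "a \<in> P" "b \<in> P" "x \<in> P" "y \<in> P" "t \<in> P"
  shows "btw a t b"
proof -
  define r where "r = m a t b"
  define u where "u = m a x t"
  define v where "v = m a y t"
  have mem: "r \<in> P" "u \<in> P" "v \<in> P"
    using P unfolding r_def u_def v_def by auto
  have u: "btw a u x" "btw a u t" "btw x u t" and v: "btw a v y" "btw a v t" "btw y v t"
    and r: "btw a r t"
    using btw_median[of a x t] btw_median[of a y t] btw_median[of a t b] P
    unfolding r_def u_def v_def by auto
  have "btw a u r" "btw a v r"
    using btw_glb[of a u t b] btw_glb[of a v t b] btw_trans[of a u x b] btw_trans[of a v y b]
      assms u v mem r_def by auto
  then have ru: "btw u r t" "btw v r t"
    using btw_mid[of a u r t] btw_mid[of a v r t] r P mem by blast+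
  have "btw u t y"
    using btw_mid[of x u t y] u assms mem by blast
  then have "btw v t u"
    using btw_mid[of y v t u] btw_sym[of u t y] v mem P by simp
  then have "m t u v = t"
    using P mem by (metis btw_def swap12 swap23)
  moreover have "btw t r (m t u v)"
    using btw_glb[of t r u v] ru btw_sym[of u r t] btw_sym[of v r t] P mem by simp
  ultimately have "r = t"
    using P mem unfolding btw_def by (metis idem_outer)
  then show ?thesis
    using P unfolding r_def btw_def by simp
qed

text \<open>\<open>s = m x y t\<close> projects \<open>t\<close> to the interval from
  \<open>x\<close> to \<open>y\<close>, so it lies between \<open>t\<close> and \<open>j\<close>.
  Since \<open>t\<close> lies between \<open>j\<close> and \<open>a\<close>, it also lies between
  \<open>s\<close> and \<open>a\<close>.\<close>

lemma below_median:
  assumes "btw a t j" "btw x j y" and P: "a \<in> P" "j \<in> P" "x \<in> P" "y \<in> P" "t \<in> P"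
  shows "btw a t (m x y t)"
proof -
  define s where "s = m x y t"
  have s: "s \<in> P" "s = m t x y"
    using P unfolding s_def by (auto simp: swap12 swap23)
  have "btw j s t"
    using btw_meet[of x j y t] s assms btw_sym[of t s j] by auto
  moreover have "btw j t a"
    using assms btw_sym[of a t j] by simp
  ultimately have "btw s t a"
    using btw_mid[of j s t a] P s by simp
  then show ?thesis
    using P s btw_sym[of s t a] unfolding s_def by simp
qed

text \<open>By \<open>btw_meet\<close>, \<open>T\<close> lies above the meet of \<open>X\<close> and
  \<open>Y\<close> from either end of the interval, so \<open>below_median\<close> places it below
  \<open>s\<close> from both ends. Convexity keeps \<open>s\<close> in the interval, which forces
  \<open>s = T\<close>.\<close>

lemma btw_gate:
  assumes "btw x t y" and P: "a \<in> P" "b \<in> P" "x \<in> P" "y \<in> P" "t \<in> P"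
  shows "btw (m a b x) (m a b t) (m a b y)"
proof -
  define X where "X = m a b x"
  define Y where "Y = m a b y"
  define T where "T = m a b t"
  define s where "s = m X Y T"
  have mem: "X \<in> P" "Y \<in> P" "T \<in> P" "s \<in> P"
    using P unfolding X_def Y_def T_def s_def by auto
  have int: "btw a X b" "btw a Y b" "btw a T b"
    using btw_median[of a b] P unfolding X_def Y_def T_def by auto
  have lower: "btw a (m a X Y) T"
    if "a \<in> P" "b \<in> P" "X = m a b x" "Y = m a b y" "T = m a b t" for a b
  proof -
    have "m a X Y = m a b (m a x y)"
      using that P assoc[of x a b] by (smt (verit) assoc closed idem swap12 swap23)
    moreover have "btw a (m a x y) t"
      using btw_meet assms that by blast
    moreover have "btw a (m a b (m a x y)) b" "btw a (m a b (m a x y)) (m a x y)"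
      using that P btw_median[of a b "m a x y"] by auto
    ultimately show ?thesis
      using that P btw_trans[of a "m a X Y" "m a x y" t] btw_glb[of a "m a X Y" b t] by simp
  qed
  have "btw a (m a X Y) T" "btw b (m b X Y) T"
    using lower[of a b] lower[of b a] P swap12[of b a] unfolding X_def Y_def T_def by auto
  moreover have "btw a (m a X Y) b" "btw b (m b X Y) a"
    using btw_median[of a X Y] btw_median[of b X Y] btw_trans[of a "m a X Y" X b]
      btw_trans[of b "m b X Y" X a] int btw_sym[of a X b] mem P by auto
  ultimately have "btw b T (m a X Y)" "btw a T (m b X Y)"
    using btw_mid[of a "m a X Y" T b] btw_mid[of b "m b X Y" T a] int btw_sym[of a T b]
      btw_sym[of "m a X Y" T b] btw_sym[of "m b X Y" T a] mem P
    by auto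
  then have "btw b T s" "btw a T s"
    using below_median[of b T "m a X Y" X Y] below_median[of a T "m b X Y" X Y]
      btw_median(3)[of a X Y] btw_median(3)[of b X Y] mem P unfolding s_def by auto
  moreover have "btw a s b"
    using interval_convex[of a X b Y s] int btw_median[of X Y T] mem P unfolding s_def by simp
  ultimately have "s = T"
    using btw_antisym[of b s T] btw_mid[of a T s b] btw_sym[of T s b] mem P by simp
  then show ?thesis
    using mem unfolding s_def btw_def X_def Y_def T_def by (metis swap23)
qed

text \<open>The image of a median lies between each two of the three images, and by
  \<open>median_unique\<close> only their median does.\<close>

lemma gate_hom:
  assumes "a \<in> P" "b \<in> P" "x \<in> P" "y \<in> P" "z \<in> P"
  shows "m a b (m x y z) = m (m a b x) (m a b y) (m a b z)"
  using assms btw_median[of x y z]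
  by (auto intro!: median_unique btw_gate)

section \<open>Halfspaces, and joins in intervals\<close>

definition halfspace :: "('p \<Rightarrow> bool) \<Rightarrow> bool" where
  "halfspace h \<longleftrightarrow> (\<forall>x\<in>P. \<forall>y\<in>P. \<forall>z\<in>P. h (m x y z) = maj (h x) (h y) (h z))"

lemma halfspaceD:
  "halfspace h \<Longrightarrow> x \<in> P \<Longrightarrow> y \<in> P \<Longrightarrow> z \<in> P \<Longrightarrow> h (m x y z) = maj (h x) (h y) (h z)"
  by (simp add: halfspace_def)

lemma halfspace_not: "halfspace h \<Longrightarrow> halfspace (\<lambda>x. \<not> h x)"
  by (auto simp: halfspace_def maj_def)

end

locale finite_median_alg = median_alg P m
  for P :: "'p set" and m +
  assumes finite_P: "finite P"
begin

text \<open>If c is minimal above a in the interval from a to b, then the interval from a to c is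
  {a, c}, and projecting to it is a homomorphism onto a two-point median algebra.\<close>

lemma halfspace_separates:
  assumes P: "a \<in> P" "b \<in> P" and "a \<noteq> b"
  obtains h where "halfspace h" "\<not> h a" "h b"
proof -
  define S where "S = {c \<in> P. btw a c b \<and> c \<noteq> a}"
  \<comment> \<open>The down set over \<open>a\<close> gets strictly smaller below a point, so a
    minimiser of its size in \<open>S\<close> is an atom.\<close>
  define f where "f c = card {d \<in> P. btw a d c}" for c
  have "b \<in> S"
    using assms by (simp add: S_def btw_def)
  then obtain c where c: "c \<in> S" and min: "\<And>d. d \<in> S \<Longrightarrow> f c \<le> f d"
    using ex_has_least_nat[of "\<lambda>c. c \<in> S" b f] by blast
  have cP: "c \<in> P" "btw a c b" "c \<noteq> a"
    using c by (auto simp: S_def)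
  have atom: "d = a \<or> d = c" if d: "d \<in> P" "btw a d c" for d
  proof (rule ccontr)
    assume neg: "\<not> (d = a \<or> d = c)"
    have "d \<in> S"
      using neg d cP P btw_trans[of a d c b] by (auto simp: S_def)
    moreover have "{e \<in> P. btw a e d} \<subset> {e \<in> P. btw a e c}"
    proof
      show "{e \<in> P. btw a e d} \<subseteq> {e \<in> P. btw a e c}"
        using d cP P btw_trans[of a _ d c] by auto
      have "\<not> btw a c d"
        using neg d cP P btw_antisym[of a c d] by auto
      moreover have "btw a c c"
        using cP P by (simp add: btw_def)
      ultimately show "{e \<in> P. btw a e d} \<noteq> {e \<in> P. btw a e c}"
        using cP by blast
    qed
    then have "f d < f c"
      unfolding f_def using finite_P by (intro psubset_card_mono) auto
    ultimately show False
      using min[of d] by simp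
  qed
  have gate: "m a c x = a \<or> m a c x = c" if "x \<in> P" for x
    using atom[of "m a c x"] btw_median(1)[of a c x] that cP P by simp
  show thesis
  proof
    show "halfspace (\<lambda>x. m a c x = c)"
      unfolding halfspace_def
    proof (intro ballI)
      fix x y z assume "x \<in> P" "y \<in> P" "z \<in> P"
      then show "(m a c (m x y z) = c) = maj (m a c x = c) (m a c y = c) (m a c z = c)"
        using gate_hom[of a c x y z] gate[of x] gate[of y] gate[of z] cP P
        by (auto simp: maj_def)
    qed
    show "\<not> m a c a = c"
      using cP P by simp
    show "m a c b = c"
      using cP by (simp add: btw_def)
  qed
qed

lemma halfspace_eqI:
  assumes "x \<in> P" "y \<in> P" "\<And>h. halfspace h \<Longrightarrow> h x = h y"
  shows "x = y"
  using assms halfspace_separates by metis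

text \<open>A halfspace that does not separate \<open>a\<close> from \<open>b\<close> is constant on
  the interval; complementing makes the others exclude \<open>a\<close>.\<close>

lemma interval_eqI:
  assumes P: "a \<in> P" "b \<in> P" "x \<in> P" "y \<in> P" and "btw a x b" "btw a y b"
    and eq: "\<And>h. halfspace h \<Longrightarrow> \<not> h a \<Longrightarrow> h b \<Longrightarrow> h x = h y"
  shows "x = y"
proof (rule halfspace_eqI)
  fix h assume h: "halfspace h"
  have "h x = maj (h a) (h x) (h b)" "h y = maj (h a) (h y) (h b)"
    using halfspaceD[OF h, of a x b] halfspaceD[OF h, of a y b] assms by (auto simp: btw_def)
  then show "h x = h y"
    using eq[OF h] eq[OF halfspace_not[OF h]] by (auto simp: maj_def)
qed (use P in auto)

text \<open>In an interval from \<open>a\<close> to \<open>b\<close>, the meet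
  \<open>m s b t\<close> seen from \<open>b\<close> is the join seen from \<open>a\<close>.\<close>

definition join :: "'p \<Rightarrow> 'p list \<Rightarrow> 'p \<Rightarrow> 'p" where
  "join b ss z = foldr (\<lambda>s t. m s b t) ss z"

lemma join_simps [simp]: "join b [] z = z" "join b (s # ss) z = m s b (join b ss z)"
  by (simp_all add: join_def)

lemma join_closed: "b \<in> P \<Longrightarrow> z \<in> P \<Longrightarrow> set ss \<subseteq> P \<Longrightarrow> join b ss z \<in> P"
  by (induction ss) auto

text \<open>A majority vote in which \<open>h b\<close> is true is a disjunction.\<close>

lemma halfspace_join:
  assumes "halfspace h" "h b" "b \<in> P" "z \<in> P" "set ss \<subseteq> P"
  shows "h (join b ss z) \<longleftrightarrow> h z \<or> (\<exists>s\<in>set ss. h s)"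
  using assms(5)
proof (induction ss)
  case (Cons s ss)
  then have "h (join b (s # ss) z) = maj (h s) (h b) (h (join b ss z))"
    using halfspaceD[OF assms(1)] join_closed assms by auto
  then show ?case
    using Cons assms by (auto simp: maj_def)
qed simp

lemma btw_join2:
  assumes "a \<in> P" "b \<in> P" "s \<in> P" "t \<in> P" "btw a s b" "btw a t b"
  shows "btw a (m s b t) b"
  using interval_convex[of a s b t "m s b t"] btw_median(2)[of s b t] assms by simp

lemma btw_join:
  assumes "a \<in> P" "b \<in> P" "z \<in> P" "btw a z b" "set ss \<subseteq> P" "\<forall>s\<in>set ss. btw a s b"
  shows "btw a (join b ss z) b"
  using assms(5,6)
proof (induction ss)
  case (Cons s ss)
  then show ?case
    using btw_join2[of a b s "join b ss z"] join_closed[of b z ss] assms by simp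
qed (use assms in simp)

end

section \<open>Cubes inside median algebras\<close>

lemma cube_median_nth:
  assumes "x \<in> cube k" "y \<in> cube k" "z \<in> cube k" "i < k"
  shows "cube_median x y z ! i = maj (x ! i) (y ! i) (z ! i)"
  using assms by (simp add: cube_median_def cube_def)

lemma cube_median_append:
  assumes "x \<in> cube k" "y \<in> cube k" "z \<in> cube k"
  shows "cube_median (x @ u) (y @ v) (z @ w) = cube_median x y z @ cube_median u v w"
  using assms by (simp add: cube_median_def cube_def)

text \<open>Padding with \<open>False\<close> embeds the smaller cube. Hence an algebra of rank
  above \<open>n\<close> contains a cube of dimension exactly \<open>n + 1\<close>.\<close>

lemma has_cube_subalgebra_mono:
  assumes "has_cube_subalgebra P m k" "j \<le> k"
  shows "has_cube_subalgebra P m j"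
proof -
  obtain f where f: "f ` cube k \<subseteq> P" "inj_on f (cube k)"
    "\<And>x y z. x \<in> cube k \<Longrightarrow> y \<in> cube k \<Longrightarrow> z \<in> cube k \<Longrightarrow> f (cube_median x y z) = m (f x) (f y) (f z)"
    using assms(1) unfolding has_cube_subalgebra_def by blast
  define r where "r = replicate (k - j) False"
  have ext: "x @ r \<in> cube k" if "x \<in> cube j" for x
    using that assms(2) by (simp add: cube_def r_def)
  have r: "cube_median r r r = r"
    by (rule nth_equalityI) (auto simp: cube_median_def maj_def r_def)
  show ?thesis
    unfolding has_cube_subalgebra_def
  proof (intro exI[of _ "\<lambda>x. f (x @ r)"] conjI ballI)
    show "(\<lambda>x. f (x @ r)) ` cube j \<subseteq> P"
      using f(1) ext by auto
    show "inj_on (\<lambda>x. f (x @ r)) (cube j)"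
      using f(2) ext unfolding inj_on_def by blast
    fix x y z assume "x \<in> cube j" "y \<in> cube j" "z \<in> cube j"
    then show "f (cube_median x y z @ r) = m (f (x @ r)) (f (y @ r)) (f (z @ r))"
      using f(3)[of "x @ r" "y @ r" "z @ r"] ext cube_median_append[of x j y z r r r] r by simp
  qed
qed

context finite_median_alg
begin

text \<open>Over the base point a, the assumption disj says that the pairwise meets of the e i lie
  below z, and ne that no e i does.\<close>

lemma cube_of_disjoint:
  assumes P: "a \<in> P" "b \<in> P" "z \<in> P" and z: "btw a z b"
    and e: "\<And>i. i < k \<Longrightarrow> e i \<in> P \<and> btw a (e i) b"
    and disj: "\<And>h i j. halfspace h \<Longrightarrow> \<not> h a \<Longrightarrow> h b \<Longrightarrow> i < k \<Longrightarrow> j < k \<Longrightarrow> i \<noteq> j \<Longrightarrow>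
       h (e i) \<Longrightarrow> h (e j) \<Longrightarrow> h z"
    and ne: "\<And>i. i < k \<Longrightarrow> m (e i) b z \<noteq> z"
  shows "has_cube_subalgebra P m k"
proof -
  define F where "F x = join b (map e (filter (\<lambda>i. x ! i) [0..<k])) z" for x
  have FP: "F x \<in> P" and Fb: "btw a (F x) b" for x
    unfolding F_def using P z e by (auto intro!: join_closed btw_join)
  have hF: "h (F x) \<longleftrightarrow> h z \<or> (\<exists>i<k. x ! i \<and> h (e i))" if "halfspace h" "h b" for h x
    unfolding F_def using P e that by (subst halfspace_join) auto
  show ?thesis
    unfolding has_cube_subalgebra_def
  proof (intro exI[of _ F] conjI ballI)
    show "F ` cube k \<subseteq> P"
      using FP by auto
    show "inj_on F (cube k)"
    proof (rule inj_onI)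
      fix x y assume xy: "x \<in> cube k" "y \<in> cube k" "F x = F y"
      have "x ! i = y ! i" if i: "i < k" for i
      proof -
        \<comment> \<open>A halfspace separating \<open>z\<close> from its join with
          \<open>e i\<close> contains \<open>e i\<close> but not \<open>z\<close>. By
          \<open>disj\<close> it contains no other \<open>e j\<close>, so on \<open>F w\<close> it
          reads off coordinate \<open>i\<close> of \<open>w\<close>.\<close>
        have "m (e i) b z \<in> P" "btw a (m (e i) b z) b"
          using e[OF i] P z btw_join2 by auto
        then obtain h where h: "halfspace h" "\<not> h a" "h b" "h (m (e i) b z) \<noteq> h z"
          using interval_eqI[of a b "m (e i) b z" z] ne[OF i] P z by blast
        have "h (m (e i) b z) = maj (h (e i)) (h b) (h z)"
          using halfspaceD h e[OF i] P by blast
        then have hi: "h (e i)" "\<not> h z"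
          using h by (auto simp: maj_def)
        have "h (F w) \<longleftrightarrow> w ! i" for w
          using hF[OF h(1,3)] disj[OF h(1-3) i] hi i by metis
        then show ?thesis
          using xy by metis
      qed
      then show "x = y"
        using xy by (intro nth_equalityI) (auto simp: cube_def)
    qed
    fix x y w assume c: "x \<in> cube k" "y \<in> cube k" "w \<in> cube k"
    show "F (cube_median x y w) = m (F x) (F y) (F w)"
    proof (rule interval_eqI[of a b])
      show "btw a (m (F x) (F y) (F w)) b"
        using interval_convex[of a "F x" b "F y"] btw_median(1)[of "F x" "F y" "F w"] Fb FP P
        by simp
      fix h assume h: "halfspace h" "\<not> h a" "h b"
      have "h (m (F x) (F y) (F w)) = maj (h (F x)) (h (F y)) (h (F w))"
        using halfspaceD h FP by blast
      \<comment> \<open>After \<open>F\<close>, such an \<open>h\<close> is constant in the first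
        two cases and a coordinate in the third; both commute with majority.\<close>
      moreover consider "h z" | "\<forall>i<k. \<not> h (e i)"
        | i where "\<not> h z" "i < k" "h (e i)" "\<forall>j<k. h (e j) \<longrightarrow> j = i"
        using disj[OF h] by blast
      then have "h (F (cube_median x y w)) = maj (h (F x)) (h (F y)) (h (F w))"
      proof cases
        case 1
        then show ?thesis
          using hF[OF h(1,3)] by (simp add: maj_def)
      next
        case 2
        then have "h (F v) \<longleftrightarrow> h z" for v
          using hF[OF h(1,3)] by blast
        then show ?thesis
          by (simp add: maj_def)
      next
        case (3 i)
        then have "h (F v) \<longleftrightarrow> v ! i" for v
          using hF[OF h(1,3)] by blast
        then show ?thesis
          using cube_median_nth[OF c 3(2)] by simp
      qed
      ultimately show "h (F (cube_median x y w)) = h (m (F x) (F y) (F w))"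
        by simp
    qed (use P FP Fb in auto)
  qed
qed

section \<open>Quotients that identify two given points\<close>

context
  fixes x y :: 'p
  assumes xy: "x \<in> P" "y \<in> P"
begin

text \<open>A congruence, as halfspaces turn medians into majorities, and one that identifies
  \<open>x\<close> with \<open>y\<close>.\<close>

definition collapsed :: "'p \<Rightarrow> 'p \<Rightarrow> bool" where
  "collapsed u v \<longleftrightarrow> (\<forall>h. halfspace h \<and> h x = h y \<longrightarrow> h u = h v)"

text \<open>The quotient is realised on representatives inside \<open>P\<close>, so the carrier type
  and the map to the space stay the same when collapses are iterated.\<close>

definition collapse_rep :: "'p \<Rightarrow> 'p" where
  "collapse_rep u = (SOME v. v \<in> P \<and> collapsed u v)"

lemma collapse_rep:
  assumes "u \<in> P"
  shows "collapse_rep u \<in> P" "collapsed u (collapse_rep u)"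
proof -
  have "u \<in> P \<and> collapsed u u"
    using assms by (simp add: collapsed_def)
  then have "collapse_rep u \<in> P \<and> collapsed u (collapse_rep u)"
    unfolding collapse_rep_def by (rule someI)
  then show "collapse_rep u \<in> P" "collapsed u (collapse_rep u)"
    by auto
qed

lemma collapse_rep_eqI:
  assumes "collapsed u v"
  shows "collapse_rep u = collapse_rep v"
proof -
  have "collapsed u = collapsed v"
    using assms by (auto simp: collapsed_def fun_eq_iff)
  then show ?thesis
    by (simp add: collapse_rep_def)
qed

lemma collapse_rep_idem: "u \<in> P \<Longrightarrow> collapse_rep (collapse_rep u) = collapse_rep u"
  using collapse_rep_eqI[OF collapse_rep(2)] by simp

lemma collapse_rep_median:
  assumes "u \<in> P" "v \<in> P" "w \<in> P"
  shows "collapse_rep (m (collapse_rep u) v w) = collapse_rep (m u v w)"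
    "collapse_rep (m u (collapse_rep v) w) = collapse_rep (m u v w)"
    "collapse_rep (m u v (collapse_rep w)) = collapse_rep (m u v w)"
  using collapse_rep[of u] collapse_rep[of v] collapse_rep[of w] assms
  by (intro collapse_rep_eqI; auto simp: collapsed_def halfspaceD)+

definition collapse_median :: "'p \<Rightarrow> 'p \<Rightarrow> 'p \<Rightarrow> 'p" where
  "collapse_median u v w = collapse_rep (m u v w)"

lemma median_algebra_collapse: "median_algebra (collapse_rep ` P) collapse_median"
proof -
  have "\<forall>a\<in>P. collapse_rep a \<in> P"
    using collapse_rep by blast
  then show ?thesis
    unfolding median_algebra_def
    by (auto simp: collapse_median_def collapse_rep_idem collapse_rep_median assoc
        intro: arg_cong[of _ _ collapse_rep] swap12 swap23)
qed

lemma card_collapse: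
  assumes "x \<noteq> y"
  shows "card (collapse_rep ` P) < card P"
proof -
  have "collapse_rep x = collapse_rep y"
    by (rule collapse_rep_eqI) (simp add: collapsed_def)
  then have "\<not> inj_on collapse_rep P"
    using assms xy by (auto simp: inj_on_def)
  then show ?thesis
    using card_image_le[OF finite_P, of collapse_rep] eq_card_imp_inj_on[OF finite_P]
    by (metis le_neq_implies_less)
qed

text \<open>Test on a halfspace \<open>h\<close>. If \<open>h u = h v\<close>, both inner medians
  take that value. Otherwise \<open>h\<close> separates \<open>x\<close> from \<open>y\<close>, the
  inner medians take the distinct values \<open>h x\<close> and \<open>h y\<close>, and the last
  argument decides.\<close>

lemma collapsed_between:
  assumes "collapsed u v" "u \<in> P" "v \<in> P"
  shows "m (m u v x) (m u v y) u = u" "m (m u v x) (m u v y) v = v"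
proof -
  show "m (m u v x) (m u v y) u = u"
  proof (rule halfspace_eqI)
    fix h assume "halfspace h"
    then show "h (m (m u v x) (m u v y) u) = h u"
      using assms xy by (auto simp: collapsed_def halfspaceD maj_def)
  qed (use assms xy in auto)
  show "m (m u v x) (m u v y) v = v"
  proof (rule halfspace_eqI)
    fix h assume "halfspace h"
    then show "h (m (m u v x) (m u v y) v) = h v"
      using assms xy by (auto simp: collapsed_def halfspaceD maj_def)
  qed (use assms xy in auto)
qed

end

end

section \<open>Generated subalgebras and their size\<close>

inductive_set generated :: "('p \<Rightarrow> 'p \<Rightarrow> 'p \<Rightarrow> 'p) \<Rightarrow> 'p set \<Rightarrow> 'p set" for m B where
  base: "b \<in> B \<Longrightarrow> b \<in> generated m B"
| step: "x \<in> generated m B \<Longrightarrow> y \<in> generated m B \<Longrightarrow> z \<in> generated m B \<Longrightarrow>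
    m x y z \<in> generated m B"

context finite_median_alg
begin

lemma generated_subset: "B \<subseteq> P \<Longrightarrow> generated m B \<subseteq> P"
proof
  fix x assume "B \<subseteq> P" "x \<in> generated m B"
  from this(2,1) show "x \<in> P"
    by (induction) auto
qed

lemma finite_median_alg_generated:
  assumes "B \<subseteq> P"
  shows "finite_median_alg (generated m B) m"
proof
  note sub = subsetD[OF generated_subset[OF assms]]
  show "finite (generated m B)"
    using generated_subset[OF assms] finite_P finite_subset by blast
  show "median_algebra (generated m B) m"
    unfolding median_algebra_def
    by (intro conjI ballI generated.step; (intro idem swap12 swap23 assoc)?)
      (auto dest: sub)
qed

text \<open>A point is determined by the halfspaces of the generated subalgebra that contain it, and
  such a halfspace by its trace on \<open>B\<close>. So \<open>g\<close> is injective into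
  \<open>Pow (Pow B)\<close>.\<close>

lemma card_generated:
  assumes "B \<subseteq> P"
  shows "card (generated m B) \<le> 2 ^ 2 ^ card B"
proof -
  interpret G: finite_median_alg "generated m B" m
    using assms by (rule finite_median_alg_generated)
  define g where "g x = {S. S \<subseteq> B \<and> (\<exists>h. G.halfspace h \<and> (\<forall>b\<in>B. h b \<longleftrightarrow> b \<in> S) \<and> h x)}" for x
  have fin: "finite B"
    using assms finite_P finite_subset by blast
  have agree: "h x = h' x"
    if "G.halfspace h" "G.halfspace h'" "\<forall>b\<in>B. h b = h' b" "x \<in> generated m B" for h h' x
    using that(4) by induction (use that(1-3) in \<open>auto simp: G.halfspaceD\<close>)
  have "inj_on g (generated m B)"
  proof (rule inj_onI, rule ccontr)
    fix x y assume xy: "x \<in> generated m B" "y \<in> generated m B" "g x = g y" "x \<noteq> y"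
    then obtain h where h: "G.halfspace h" "\<not> h y" "h x"
      using G.halfspace_separates[of y x] by metis
    then have "{b \<in> B. h b} \<in> g x"
      by (auto simp: g_def)
    then have "{b \<in> B. h b} \<in> g y"
      using xy by simp
    then obtain h' where h': "G.halfspace h'" "\<forall>b\<in>B. h' b \<longleftrightarrow> h b" "h' y"
      by (auto simp: g_def)
    then show False
      using agree[of h' h y] h xy by auto
  qed
  moreover have "g ` generated m B \<subseteq> Pow (Pow B)"
    by (auto simp: g_def)
  ultimately have "card (generated m B) \<le> card (Pow (Pow B))"
    using fin by (intro card_inj_on_le) auto
  then show ?thesis
    using fin by (simp add: card_Pow)
qed

end

section \<open>Coarse median spaces and approximate homomorphisms\<close>

locale coarse_median_space =
  fixes mu :: "'a::metric_space \<Rightarrow> 'a \<Rightarrow> 'a \<Rightarrow> 'a" and K H0 :: real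
  assumes mu_idem: "mu a a b = a"
    and mu_swap12: "mu a b c = mu b a c"
    and mu_swap23: "mu a b c = mu a c b"
    and C1: "cm_C1 mu K H0"
    and K_nonneg: "0 \<le> K"
begin

lemma mu_dist:
  assumes "dist a a' \<le> r" "dist b b' \<le> s" "dist c c' \<le> t"
  shows "dist (mu a b c) (mu a' b' c') \<le> K * (r + s + t) + H0"
proof -
  have "dist (mu a b c) (mu a' b' c') \<le> K * (dist a a' + dist b b' + dist c c') + H0"
    using C1 by (simp add: cm_C1_def)
  also have "\<dots> \<le> K * (r + s + t) + H0"
    using assms K_nonneg by (intro add_right_mono mult_left_mono) auto
  finally show ?thesis .
qed

lemma H0_nonneg: "0 \<le> H0"
  using mu_dist[of undefined undefined 0 undefined undefined 0 undefined undefined 0] by simp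

definition approx_hom :: "real \<Rightarrow> 'p set \<Rightarrow> ('p \<Rightarrow> 'p \<Rightarrow> 'p \<Rightarrow> 'p) \<Rightarrow> ('p \<Rightarrow> 'a) \<Rightarrow> bool" where
  "approx_hom H P m lam \<longleftrightarrow>
     (\<forall>x\<in>P. \<forall>y\<in>P. \<forall>z\<in>P. dist (lam (m x y z)) (mu (lam x) (lam y) (lam z)) \<le> H)"

lemma approx_homD:
  "approx_hom H P m lam \<Longrightarrow> x \<in> P \<Longrightarrow> y \<in> P \<Longrightarrow> z \<in> P \<Longrightarrow>
    dist (lam (m x y z)) (mu (lam x) (lam y) (lam z)) \<le> H"
  by (simp add: approx_hom_def)

text \<open>Joining one more point is compared with
  \<open>mu (lam a) (lam b) (lam a) = lam a\<close>, which turns an error \<open>g\<close> into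
  \<open>H + K * (D + g) + H0\<close>. The final bound depends on the list only through
  \<open>D\<close> and its length.\<close>

lemma dist_join:
  assumes "finite_median_alg P m" and hom: "approx_hom H P m lam"
    and P: "a \<in> P" "b \<in> P" "set ss \<subseteq> P"
    and D: "\<forall>s\<in>set ss. dist (lam s) (lam a) \<le> D"
  shows "dist (lam (finite_median_alg.join m b ss a)) (lam a)
    \<le> ((\<lambda>g. H + K * (D + g) + H0) ^^ length ss) 0"
proof -
  interpret finite_median_alg P m by fact
  show ?thesis
    using P(3) D
  proof (induction ss)
    case (Cons s ss)
    define g where "g = ((\<lambda>g. H + K * (D + g) + H0) ^^ length ss) 0"
    define t where "t = join b ss a"
    have t: "t \<in> P" "dist (lam t) (lam a) \<le> g"
      using Cons P join_closed by (auto simp: t_def g_def)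
    have "dist (lam (m s b t)) (mu (lam s) (lam b) (lam t)) \<le> H"
      using approx_homD[OF hom] Cons P t by simp
    moreover have "dist (mu (lam s) (lam b) (lam t)) (mu (lam a) (lam b) (lam a))
        \<le> K * (D + 0 + g) + H0"
      using Cons t by (intro mu_dist) auto
    moreover have "mu (lam a) (lam b) (lam a) = lam a"
      by (metis mu_idem mu_swap23)
    ultimately have "dist (lam (m s b t)) (lam a) \<le> H + K * (D + g) + H0"
      using dist_triangle[of "lam (m s b t)" "lam a" "mu (lam s) (lam b) (lam t)"] by simp
    then show ?case
      by (simp add: t_def g_def)
  qed simp
qed

section \<open>From the rank bound to disjoint points in intervals\<close>

lemma disjoint_bound_of_rank:
  assumes C2: "cm_C2 mu H (Some n)" and "lambda > 0"
  shows "\<exists>C. \<forall>a b (e::nat \<Rightarrow> 'a).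
    (\<forall>i<n+1. e i \<in> cm_interval mu a b) \<and>
    (\<forall>i<n+1. \<forall>j<n+1. i \<noteq> j \<longrightarrow> close (mu (e i) a (e j)) lambda a)
    \<longrightarrow> (\<exists>i<n+1. close (e i) C a)"
proof -
  \<comment> \<open>\<open>n + 3\<close> counts \<open>a\<close>, \<open>b\<close> and the
    \<open>n + 1\<close> points \<open>y i\<close> that witness membership in the interval.\<close>
  define q where "q = H (n + 3)"
  \<comment> \<open>\<open>E\<close> bounds the distance from \<open>lam (e' i)\<close> to
    \<open>e i\<close>, \<open>D\<close> that from the images of the pairwise meets to
    \<open>lam a'\<close>, and \<open>G\<close> that from \<open>lam z\<close> to
    \<open>lam a'\<close>; \<open>C\<close> adds up the path from \<open>e i\<close> to
    \<open>a\<close>.\<close>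
  define E where "E = q + (K * (q + q + q) + H0)"
  define D where "D = q + (K * (E + q + E) + H0) + lambda + q"
  define G where "G = ((\<lambda>g. q + K * (D + g) + H0) ^^ ((n + 1) * (n + 1))) 0"
  define C where "C = E + (q + (K * (0 + 0 + G) + H0) + q) + G + q"
  have q: "q \<ge> 0"
    using C2 by (simp add: cm_C2_def q_def)
  then have "E \<ge> 0"
    using K_nonneg H0_nonneg by (simp add: E_def)
  then have D0: "D \<ge> 0"
    using K_nonneg H0_nonneg q \<open>lambda > 0\<close> by (simp add: D_def)
  have "\<exists>i<n+1. close (e i) C a"
    if e: "\<forall>i<n+1. e i \<in> cm_interval mu a b"
      and disj: "\<forall>i<n+1. \<forall>j<n+1. i \<noteq> j \<longrightarrow> close (mu (e i) a (e j)) lambda a"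
    for a b e
  proof -
    have "\<forall>i. \<exists>y. i < n+1 \<longrightarrow> e i = mu a y b"
      using e by (auto simp: cm_interval_def)
    then obtain y where y: "\<And>i. i < n+1 \<Longrightarrow> e i = mu a (y i) b"
      by metis
    \<comment> \<open>Approximating the \<open>y i\<close> instead of the \<open>e i\<close> makes
      the points \<open>e' i\<close> lie exactly in the interval from \<open>a'\<close> to
      \<open>b'\<close>.\<close>
    define A where "A = insert a (insert b (y ` {..<n+1}))"
    have "card (y ` {..<n+1}) \<le> n + 1"
      using card_image_le[of "{..<n+1}" y] by simp
    then have "card A \<le> n + 3"
      unfolding A_def by (simp add: card_insert_if)
    moreover have A: "finite A" "a \<in> A" "b \<in> A" "\<And>i. i < n+1 \<Longrightarrow> y i \<in> A"
      by (auto simp: A_def)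
    moreover have "1 \<le> card A"
      using A card_gt_0_iff[of A] by force
    ultimately obtain P :: "nat set" and m pi lam where
      fin: "finite P" and med: "median_algebra P m" and rank: "median_rank_le P m n"
      and pi: "pi ` A \<subseteq> P"
      and lam: "\<forall>x\<in>P. \<forall>y\<in>P. \<forall>z\<in>P. close (lam (m x y z)) q (mu (lam x) (lam y) (lam z))"
      and lampi: "\<forall>a\<in>A. close (lam (pi a)) q a"
      using C2 unfolding cm_C2_def q_def by (metis option.case(2))
    interpret finite_median_alg P m
      using fin med by unfold_locales
    have hom: "approx_hom q P m lam"
      using lam by (simp add: approx_hom_def close_def)
    define a' where "a' = pi a"
    define b' where "b' = pi b"
    define e' where "e' i = m a' b' (pi (y i))" for i
    have P: "a' \<in> P" "b' \<in> P" "\<And>i. i < n+1 \<Longrightarrow> pi (y i) \<in> P"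
      using pi A by (auto simp: a'_def b'_def)
    then have eP: "e' i \<in> P" "btw a' (e' i) b'" if "i < n+1" for i
      using btw_median(1)[of a' b' "pi (y i)"] that by (auto simp: e'_def)
    have da: "dist (lam a') a \<le> q" "dist (lam b') b \<le> q"
      and dy: "\<And>i. i < n+1 \<Longrightarrow> dist (lam (pi (y i))) (y i) \<le> q"
      using lampi A by (auto simp: close_def a'_def b'_def)
    have de: "dist (lam (e' i)) (e i) \<le> E" if "i < n+1" for i
    proof -
      have "dist (lam (e' i)) (mu (lam a') (lam b') (lam (pi (y i)))) \<le> q"
        unfolding e'_def using approx_homD[OF hom] P that by simp
      moreover have "dist (mu (lam a') (lam b') (lam (pi (y i)))) (mu a b (y i))
          \<le> K * (q + q + q) + H0"
        using da dy that by (intro mu_dist)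
      moreover have "mu a b (y i) = e i"
        using y that mu_swap23 by simp
      ultimately show ?thesis
        unfolding E_def
        using dist_triangle[of "lam (e' i)" "e i" "mu (lam a') (lam b') (lam (pi (y i)))"]
        by simp
    qed
    \<comment> \<open>The bottom \<open>a'\<close> fills the diagonal, so the join can range over
      all \<open>(n + 1) * (n + 1)\<close> pairs.\<close>
    define meet where "meet i j = (if i = j then a' else m (e' i) a' (e' j))" for i j
    define ss where "ss = map (\<lambda>(i, j). meet i j) (List.product [0..<n+1] [0..<n+1])"
    have ss: "set ss = (\<lambda>(i, j). meet i j) ` ({..<n+1} \<times> {..<n+1})" "length ss = (n+1) * (n+1)"
      unfolding ss_def set_map set_product set_upt atLeast0LessThan by simp_all
    have meet: "meet i j \<in> P \<and> btw a' (meet i j) b' \<and> dist (lam (meet i j)) (lam a') \<le> D"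
      if ij: "i < n+1" "j < n+1" for i j
    proof (cases "i = j")
      case True
      then show ?thesis
        using P D0 by (simp add: meet_def btw_def)
    next
      case False
      define s where "s = m (e' i) a' (e' j)"
      have "dist (lam s) (mu (lam (e' i)) (lam a') (lam (e' j))) \<le> q"
        unfolding s_def using approx_homD[OF hom] P eP ij by simp
      moreover have "dist (mu (lam (e' i)) (lam a') (lam (e' j))) (mu (e i) a (e j))
          \<le> K * (E + q + E) + H0"
        using da de ij by (intro mu_dist)
      moreover have "dist (mu (e i) a (e j)) a \<le> lambda"
        using disj ij False by (simp add: close_def)
      ultimately have "dist (lam s) (lam a') \<le> D"
        unfolding D_def
        using da(1) dist_triangle[of "lam s" "lam a'" "mu (lam (e' i)) (lam a') (lam (e' j))"]
          dist_triangle[of "mu (lam (e' i)) (lam a') (lam (e' j))" "lam a'" "mu (e i) a (e j)"]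
          dist_triangle[of "mu (e i) a (e j)" "lam a'" a] dist_commute[of a "lam a'"]
        by linarith
      moreover have "s \<in> P" "btw a' s b'"
        using interval_convex[of a' "e' i" b' "e' j" s] btw_median(2)[of "e' i" a' "e' j"] eP ij P
        by (auto simp: s_def)
      ultimately show ?thesis
        using False by (simp add: meet_def s_def)
    qed
    have ssP: "set ss \<subseteq> P" "\<forall>s\<in>set ss. btw a' s b'" "\<forall>s\<in>set ss. dist (lam s) (lam a') \<le> D"
      unfolding ss using meet by auto
    define z where "z = join b' ss a'"
    have "btw a' a' b'"
      using P by (simp add: btw_def)
    then have z: "z \<in> P" "btw a' z b'"
      using join_closed[of b' a' ss] btw_join[of a' b' a' ss] ssP P by (auto simp: z_def)
    have dz: "dist (lam z) (lam a') \<le> G"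
      using dist_join[OF finite_median_alg_axioms hom, of a' b' ss D] P ssP ss(2)
      unfolding z_def G_def by simp
    have "\<exists>i<n+1. m (e' i) b' z = z"
    proof (rule ccontr)
      assume "\<not> ?thesis"
      then have "has_cube_subalgebra P m (n + 1)"
      proof (intro cube_of_disjoint[of a' b' z _ e'])
        fix h i j
        assume h: "halfspace h" "\<not> h a'" "h b'" and ij: "i < n+1" "j < n+1" "i \<noteq> j"
          and he: "h (e' i)" "h (e' j)"
        have "h (meet i j)"
          using halfspaceD[OF h(1), of "e' i" a' "e' j"] ij P eP he
          by (simp add: meet_def maj_def)
        moreover have "meet i j \<in> set ss"
          using ij by (auto simp: ss)
        ultimately show "h z"
          unfolding z_def using halfspace_join[OF h(1,3), of a' ss] ssP P by auto
      qed (use P z eP in auto)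
      then show False
        using rank unfolding median_rank_le_def by fastforce
    qed
    then obtain i where i: "i < n+1" "m (e' i) b' z = z"
      by blast
    \<comment> \<open>\<open>e' i\<close> and \<open>z\<close> are the values of
      \<open>m (e' i) b'\<close> at \<open>a'\<close> and at \<open>z\<close>. As the images of
      \<open>a'\<close> and \<open>z\<close> are within \<open>G\<close>, those of
      \<open>e' i\<close> and \<open>z\<close> are close as well.\<close>
    have "m (e' i) b' a' = e' i"
      using btw_sym[of a' "e' i" b'] eP[OF i(1)] P swap12[of "e' i" b' a'] by (simp add: btw_def)
    then have 1: "dist (lam (e' i)) (mu (lam (e' i)) (lam b') (lam a')) \<le> q"
      using approx_homD[OF hom, of "e' i" b' a'] P eP[OF i(1)] by simp
    have 2: "dist (lam z) (mu (lam (e' i)) (lam b') (lam z)) \<le> q"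
      using approx_homD[OF hom, of "e' i" b' z] P eP[OF i(1)] z i by simp
    have 3: "dist (mu (lam (e' i)) (lam b') (lam z)) (mu (lam (e' i)) (lam b') (lam a'))
        \<le> K * (0 + 0 + G) + H0"
      using dz by (intro mu_dist) auto
    have "dist (lam z) (lam (e' i)) \<le> q + (K * (0 + 0 + G) + H0) + q"
      using 1 2 3 dist_triangle[of "lam z" "lam (e' i)" "mu (lam (e' i)) (lam b') (lam z)"]
        dist_triangle[of "mu (lam (e' i)) (lam b') (lam z)" "lam (e' i)"
          "mu (lam (e' i)) (lam b') (lam a')"]
        dist_commute[of "lam (e' i)" "mu (lam (e' i)) (lam b') (lam a')"]
      by linarith
    then have "dist (e i) a \<le> C"
      using de[OF i(1)] dz da(1) dist_triangle[of "e i" a "lam (e' i)"]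
        dist_triangle[of "lam (e' i)" a "lam z"] dist_triangle[of "lam z" a "lam a'"]
        dist_commute[of "e i" "lam (e' i)"] dist_commute[of "lam z" "lam (e' i)"]
      unfolding C_def by linarith
    then show ?thesis
      using i by (auto simp: close_def)
  qed
  then show ?thesis
    by blast
qed

section \<open>From disjoint points to short edges of cubes\<close>

lemma cube_bound_of_disjoint_bound:
  assumes bound: "\<forall>lambda>0. \<exists>C. \<forall>a b (e::nat \<Rightarrow> 'a).
      (\<forall>i<n+1. e i \<in> cm_interval mu a b) \<and>
      (\<forall>i<n+1. \<forall>j<n+1. i \<noteq> j \<longrightarrow> close (mu (e i) a (e j)) lambda a)
      \<longrightarrow> (\<exists>i<n+1. close (e i) C a)"
    and "L > 0"
  shows "\<exists>C. \<forall>sg. quasi_morphism mu L (n+1) sg \<longrightarrow>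
    (\<exists>x y. cube_adjacent (n+1) x y \<and> close (sg x) C (sg y))"
proof -
  \<comment> \<open>Replacing the \<open>e i\<close> by the images of unit vectors costs
    \<open>K * (L + 0 + L) + H0\<close>; the quasi-morphism error adds \<open>L\<close>.\<close>
  define lambda where "lambda = K * (L + 0 + L) + H0 + L"
  have "lambda > 0"
    using \<open>L > 0\<close> K_nonneg H0_nonneg by (simp add: lambda_def add_nonneg_pos)
  then obtain C where C: "\<And>a b (e::nat \<Rightarrow> 'a).
      \<forall>i<n+1. e i \<in> cm_interval mu a b \<Longrightarrow>
      \<forall>i<n+1. \<forall>j<n+1. i \<noteq> j \<longrightarrow> close (mu (e i) a (e j)) lambda a \<Longrightarrow>
      \<exists>i<n+1. close (e i) C a"
    using bound by metis
  have "\<exists>x y. cube_adjacent (n+1) x y \<and> close (sg x) (C + L) (sg y)"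
    if sg: "quasi_morphism mu L (n+1) sg" for sg
  proof -
    define bot where "bot = replicate (n+1) False"
    define top where "top = replicate (n+1) True"
    define unit where "unit i = map (\<lambda>j. j = i) [0..<n+1]" for i
    \<comment> \<open>\<open>sg (unit i)\<close> need not lie in the interval, but
      \<open>e i\<close> does, and it is within \<open>L\<close> because \<open>unit i\<close> is
      the median of \<open>bot\<close>, \<open>unit i\<close> and \<open>top\<close>.\<close>
    define e where "e i = mu (sg bot) (sg (unit i)) (sg top)" for i
    have cube: "bot \<in> cube (n+1)" "top \<in> cube (n+1)" "unit i \<in> cube (n+1)" for i
      by (auto simp: cube_def bot_def top_def unit_def simp del: replicate.simps)
    have med1: "cube_median bot (unit i) top = unit i" for i
      by (rule nth_equalityI)
        (auto simp: cube_median_def unit_def bot_def top_def maj_def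
          simp del: replicate.simps upt_Suc)
    have med2: "cube_median (unit i) bot (unit j) = bot" if "i \<noteq> j" for i j
      using that by (intro nth_equalityI)
        (auto simp: cube_median_def unit_def bot_def maj_def
          simp del: replicate.simps upt_Suc)
    have de: "dist (e i) (sg (unit i)) \<le> L" for i
      using sg cube med1[of i] unfolding quasi_morphism_def close_def e_def by metis
    have "\<exists>i<n+1. close (e i) C (sg bot)"
    proof (rule C[of e "sg bot" "sg top"])
      show "\<forall>i<n+1. e i \<in> cm_interval mu (sg bot) (sg top)"
        by (auto simp: cm_interval_def e_def)
      show "\<forall>i<n+1. \<forall>j<n+1. i \<noteq> j \<longrightarrow> close (mu (e i) (sg bot) (e j)) lambda (sg bot)"
      proof (intro allI impI)
        fix i j :: nat assume "i \<noteq> j"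
        have "dist (mu (e i) (sg bot) (e j)) (mu (sg (unit i)) (sg bot) (sg (unit j)))
            \<le> K * (L + 0 + L) + H0"
          using de by (intro mu_dist) auto
        moreover have "dist (mu (sg (unit i)) (sg bot) (sg (unit j))) (sg bot) \<le> L"
          using sg cube med2[OF \<open>i \<noteq> j\<close>] unfolding quasi_morphism_def close_def by metis
        ultimately show "close (mu (e i) (sg bot) (e j)) lambda (sg bot)"
          unfolding close_def lambda_def
          using dist_triangle[of "mu (e i) (sg bot) (e j)" "sg bot"
              "mu (sg (unit i)) (sg bot) (sg (unit j))"] by linarith
      qed
    qed
    then obtain i where i: "i < n+1" "dist (e i) (sg bot) \<le> C"
      by (auto simp: close_def)
    have "{j. j < n+1 \<and> unit i ! j \<noteq> bot ! j} = {i}"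
      using i by (auto simp: unit_def bot_def simp del: replicate.simps upt_Suc)
    then have "cube_adjacent (n+1) (unit i) bot"
      using cube by (simp add: cube_adjacent_def)
    moreover have "dist (sg (unit i)) (sg bot) \<le> C + L"
      using de[of i] i dist_triangle[of "sg (unit i)" "sg bot" "e i"]
        dist_commute[of "e i" "sg (unit i)"] by linarith
    ultimately show ?thesis
      unfolding close_def by blast
  qed
  then show ?thesis
    by blast
qed

section \<open>From short edges of cubes to the rank bound\<close>

lemma dist_collapsed:
  assumes "finite_median_alg P m" and hom: "approx_hom H P m lam"
    and P: "x \<in> P" "y \<in> P" "u \<in> P" "v \<in> P" and xy: "dist (lam x) (lam y) \<le> C"
    and uv: "finite_median_alg.collapsed P m x y u v"
    and E: "E = H + (K * (0 + 0 + C) + H0) + H"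
  shows "dist (lam u) (lam v) \<le> 2 * (H + (K * (0 + E + 0) + H0))"
proof -
  interpret finite_median_alg P m by fact
  \<comment> \<open>Both \<open>u\<close> and \<open>v\<close> lie between \<open>p\<close> and
    \<open>q\<close>, whose images are within \<open>E\<close>. A median with \<open>lam p\<close>
    and \<open>lam q\<close> stays near \<open>lam p\<close>, so \<open>lam u\<close> and
    \<open>lam v\<close> do too; passing through \<open>lam p\<close> gives the factor 2.\<close>
  define p where "p = m u v x"
  define q where "q = m u v y"
  have pq: "p \<in> P" "q \<in> P" "m p q u = u" "m p q v = v"
    using P collapsed_between[OF P(1,2) uv P(3,4)] by (auto simp: p_def q_def)
  have "dist (lam p) (mu (lam u) (lam v) (lam x)) \<le> H" "dist (lam q) (mu (lam u) (lam v) (lam y)) \<le> H"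
    using approx_homD[OF hom] P by (auto simp: p_def q_def)
  moreover have "dist (mu (lam u) (lam v) (lam x)) (mu (lam u) (lam v) (lam y))
      \<le> K * (0 + 0 + C) + H0"
    using xy by (intro mu_dist) auto
  ultimately have "dist (lam q) (lam p) \<le> E"
    using dist_triangle[of "lam p" "lam q" "mu (lam u) (lam v) (lam x)"]
      dist_triangle[of "mu (lam u) (lam v) (lam x)" "lam q" "mu (lam u) (lam v) (lam y)"]
      dist_commute[of "lam q" "mu (lam u) (lam v) (lam y)"] dist_commute[of "lam q" "lam p"]
    unfolding E by linarith
  then have "dist (mu (lam p) (lam q) (lam t)) (mu (lam p) (lam p) (lam t))
      \<le> K * (0 + E + 0) + H0" for t
    by (intro mu_dist) auto
  then have *: "dist (mu (lam p) (lam q) (lam t)) (lam p) \<le> K * (0 + E + 0) + H0" for t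
    using mu_idem by simp
  have "dist (lam t) (lam p) \<le> H + (K * (0 + E + 0) + H0)" if "t \<in> P" "m p q t = t" for t
    using approx_homD[OF hom pq(1,2) that(1)] that(2) *[of t]
      dist_triangle[of "lam t" "lam p" "mu (lam p) (lam q) (lam t)"] by simp
  from this[of u] this[of v] show ?thesis
    using pq P dist_triangle[of "lam u" "lam v" "lam p"] dist_commute[of "lam v" "lam p"] by simp
qed

text \<open>Each step collapses a non-trivial pair of points with close images, so the
  cardinality drops; the bound N on it makes the final constant independent of P.\<close>

lemma reduce_rank:
  assumes bound: "\<forall>L>0. \<exists>C. \<forall>sg. quasi_morphism mu L (n+1) sg \<longrightarrow>
      (\<exists>x y. cube_adjacent (n+1) x y \<and> close (sg x) C (sg y))"
    and "H \<ge> 0"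
  shows "\<exists>H'\<ge>0. \<forall>(P :: 'p set) m (pi :: 'a \<Rightarrow> 'p) lam A.
      finite_median_alg P m \<and> card P < N \<and> approx_hom H P m lam \<and> pi ` A \<subseteq> P \<and>
      (\<forall>a\<in>A. dist (lam (pi a)) a \<le> H) \<longrightarrow>
      (\<exists>P' m' (pi' :: 'a \<Rightarrow> 'p). finite_median_alg P' m' \<and> median_rank_le P' m' n \<and>
        approx_hom H' P' m' lam \<and> pi' ` A \<subseteq> P' \<and> (\<forall>a\<in>A. dist (lam (pi' a)) a \<le> H'))"
  using \<open>H \<ge> 0\<close>
proof (induction N arbitrary: H)
  case 0
  then show ?case by auto
next
  case (Suc N)
  \<comment> \<open>\<open>bound\<close> asks for a positive \<open>L\<close>, and \<open>H\<close>
    may be 0.\<close>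
  have "H + 1 > 0"
    using Suc.prems by simp
  then obtain C0 where C0: "\<forall>sg. quasi_morphism mu (H + 1) (n+1) sg \<longrightarrow>
      (\<exists>x y. cube_adjacent (n+1) x y \<and> close (sg x) C0 (sg y))"
    using bound by blast
  define C where "C = max C0 0"
  define E where "E = H + (K * (0 + 0 + C) + H0) + H"
  define D where "D = 2 * (H + (K * (0 + E + 0) + H0))"
  have "E \<ge> 0"
    using Suc.prems K_nonneg H0_nonneg by (simp add: E_def C_def)
  then have "D \<ge> 0"
    using Suc.prems K_nonneg H0_nonneg by (simp add: D_def)
  \<comment> \<open>The quotient keeps \<open>lam\<close> and moves images of medians by at most
    \<open>D\<close>, so the induction continues with error \<open>D + H\<close>.\<close>
  then obtain H'' where IH: "H'' \<ge> 0" "\<And>(P :: 'p set) m (pi :: 'a \<Rightarrow> 'p) lam A.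
      finite_median_alg P m \<Longrightarrow> card P < N \<Longrightarrow> approx_hom (D + H) P m lam \<Longrightarrow> pi ` A \<subseteq> P \<Longrightarrow>
      (\<forall>a\<in>A. dist (lam (pi a)) a \<le> D + H) \<Longrightarrow>
      (\<exists>P' m' (pi' :: 'a \<Rightarrow> 'p). finite_median_alg P' m' \<and> median_rank_le P' m' n \<and>
        approx_hom H'' P' m' lam \<and> pi' ` A \<subseteq> P' \<and> (\<forall>a\<in>A. dist (lam (pi' a)) a \<le> H''))"
    using Suc.IH[of "D + H"] Suc.prems by force
  have mono: "approx_hom h' P' m' lam" if "approx_hom h P' m' lam" "h \<le> h'"
    for h h' m' lam and P' :: "'p set"
    using that unfolding approx_hom_def by (meson order_trans)
  have "\<exists>P' m' (pi' :: 'a \<Rightarrow> 'p). finite_median_alg P' m' \<and> median_rank_le P' m' n \<and>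
      approx_hom (max H H'') P' m' lam \<and> pi' ` A \<subseteq> P' \<and>
      (\<forall>a\<in>A. dist (lam (pi' a)) a \<le> max H H'')"
    if alg: "finite_median_alg P m" and card: "card P < Suc N" and hom: "approx_hom H P m lam"
      and pi: "pi ` A \<subseteq> P" and lampi: "\<forall>a\<in>A. dist (lam (pi a)) a \<le> H"
    for P :: "'p set" and m and pi :: "'a \<Rightarrow> 'p" and lam A
  proof (cases "median_rank_le P m n")
    case True
    then show ?thesis
      using alg pi lampi mono[OF hom, of "max H H''"] by (intro exI[of _ P] exI[of _ m] exI[of _ pi]) auto
  next
    case False
    interpret finite_median_alg P m by fact
    obtain k where "has_cube_subalgebra P m k" "n + 1 \<le> k"
      using False unfolding median_rank_le_def by fastforce
    then have "has_cube_subalgebra P m (n + 1)"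
      by (rule has_cube_subalgebra_mono)
    then obtain f where f: "f ` cube (n+1) \<subseteq> P" "inj_on f (cube (n+1))"
      "\<And>x y z. x \<in> cube (n+1) \<Longrightarrow> y \<in> cube (n+1) \<Longrightarrow> z \<in> cube (n+1) \<Longrightarrow>
        f (cube_median x y z) = m (f x) (f y) (f z)"
      unfolding has_cube_subalgebra_def by blast
    have "quasi_morphism mu (H + 1) (n+1) (\<lambda>x. lam (f x))"
      unfolding quasi_morphism_def close_def
    proof (intro ballI)
      fix x y z assume xyz: "x \<in> cube (n+1)" "y \<in> cube (n+1)" "z \<in> cube (n+1)"
      then have "f x \<in> P" "f y \<in> P" "f z \<in> P"
        using f(1) by auto
      from approx_homD[OF hom this] show "dist (mu (lam (f x)) (lam (f y)) (lam (f z))) (lam (f (cube_median x y z))) \<le> H + 1"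
        by (simp add: f(3)[OF xyz] dist_commute)
    qed
    then obtain x' y' where adj: "cube_adjacent (n+1) x' y'" and "dist (lam (f x')) (lam (f y')) \<le> C0"
      using C0 unfolding close_def by blast
    define x where "x = f x'"
    define y where "y = f y'"
    have "x' \<in> cube (n+1)" "y' \<in> cube (n+1)" "x' \<noteq> y'"
      using adj by (auto simp: cube_adjacent_def)
    then have xy: "x \<in> P" "y \<in> P" "x \<noteq> y"
      using f unfolding x_def y_def inj_on_def by blast+
    have dxy: "dist (lam x) (lam y) \<le> C"
      using \<open>dist (lam (f x')) (lam (f y')) \<le> C0\<close> by (simp add: x_def y_def C_def)
    define r where "r = collapse_rep x y"
    have r: "r u \<in> P" "dist (lam (r u)) (lam u) \<le> D" if "u \<in> P" for u
      using collapse_rep(1)[OF xy(1,2) that]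
        dist_collapsed[OF alg hom xy(1,2) that _ dxy collapse_rep(2)[OF xy(1,2) that] E_def]
      unfolding r_def D_def by (simp_all add: dist_commute)
    have "finite_median_alg (r ` P) (collapse_median x y)"
      unfolding r_def using median_algebra_collapse[OF xy(1,2)] finite_P by unfold_locales auto
    moreover have "card (r ` P) < N"
      using card_collapse[OF xy] card unfolding r_def by linarith
    moreover have "approx_hom (D + H) (r ` P) (collapse_median x y) lam"
      unfolding approx_hom_def
    proof (intro ballI)
      fix u v w assume "u \<in> r ` P" "v \<in> r ` P" "w \<in> r ` P"
      then have uvw: "u \<in> P" "v \<in> P" "w \<in> P"
        using r by auto
      then have "dist (lam (r (m u v w))) (lam (m u v w)) \<le> D"
        "dist (lam (m u v w)) (mu (lam u) (lam v) (lam w)) \<le> H"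
        using r approx_homD[OF hom] by auto
      then show "dist (lam (collapse_median x y u v w)) (mu (lam u) (lam v) (lam w)) \<le> D + H"
        using dist_triangle[of "lam (r (m u v w))" "mu (lam u) (lam v) (lam w)" "lam (m u v w)"]
        unfolding collapse_median_def[OF xy(1,2)] r_def by linarith
    qed
    moreover have "(\<lambda>a. r (pi a)) ` A \<subseteq> r ` P"
      using pi by auto
    moreover have "\<forall>a\<in>A. dist (lam (r (pi a))) a \<le> D + H"
    proof
      fix a assume "a \<in> A"
      then show "dist (lam (r (pi a))) a \<le> D + H"
        using r(2)[of "pi a"] pi lampi dist_triangle[of "lam (r (pi a))" a "lam (pi a)"] by force
    qed
    ultimately have "\<exists>P' m' (pi' :: 'a \<Rightarrow> 'p). finite_median_alg P' m' \<and> median_rank_le P' m' n \<and>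
        approx_hom H'' P' m' lam \<and> pi' ` A \<subseteq> P' \<and> (\<forall>a\<in>A. dist (lam (pi' a)) a \<le> H'')"
      by (rule IH(2))
    then obtain P' m' and pi' :: "'a \<Rightarrow> 'p" where
      "finite_median_alg P' m'" "median_rank_le P' m' n" "pi' ` A \<subseteq> P'"
      and "approx_hom H'' P' m' lam" "\<forall>a\<in>A. dist (lam (pi' a)) a \<le> H''"
      by blast
    then show ?thesis
      using mono[of H'' P' m' lam "max H H''"]
      by (intro exI[of _ P'] exI[of _ m'] exI[of _ pi']) fastforce
  qed
  then show ?case
    using Suc.prems by (intro exI[of _ "max H H''"]) auto
qed

text \<open>The subalgebra generated by the images of \<open>A\<close> has size bounded in terms of
  \<open>p\<close> alone, so \<open>reduce_rank\<close> gives one constant for all \<open>A\<close>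
  with at most \<open>p\<close> points.\<close>

lemma C2_rank_of_cube_bound:
  assumes bound: "\<forall>L>0. \<exists>C. \<forall>sg. quasi_morphism mu L (n+1) sg \<longrightarrow>
      (\<exists>x y. cube_adjacent (n+1) x y \<and> close (sg x) C (sg y))"
    and C2: "cm_C2 mu H None"
  shows "\<exists>H'. cm_C2 mu H' (Some n)"
proof -
  \<comment> \<open>The conclusion of \<open>reduce_rank\<close>, named so that \<open>H'\<close>
    can be chosen as a function of \<open>p\<close>; the \<open>+ 1\<close> is there because its
    size bound is strict.\<close>
  define reduces where "reduces p H' \<longleftrightarrow> (\<forall>(P :: nat set) m (pi :: 'a \<Rightarrow> nat) lam A.
      finite_median_alg P m \<and> card P < 2 ^ 2 ^ p + 1 \<and> approx_hom (H p) P m lam \<and> pi ` A \<subseteq> P \<and>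
      (\<forall>a\<in>A. dist (lam (pi a)) a \<le> H p) \<longrightarrow>
      (\<exists>P' m' (pi' :: 'a \<Rightarrow> nat). finite_median_alg P' m' \<and> median_rank_le P' m' n \<and>
        approx_hom H' P' m' lam \<and> pi' ` A \<subseteq> P' \<and> (\<forall>a\<in>A. dist (lam (pi' a)) a \<le> H')))"
    for p H'
  have "H p \<ge> 0" for p
    using C2 by (simp add: cm_C2_def)
  then have "\<exists>H'\<ge>0. reduces p H'" for p
    unfolding reduces_def by (intro reduce_rank[OF bound])
  then obtain H' where H': "\<And>p. H' p \<ge> 0" "\<And>p. reduces p (H' p)"
    by metis
  have "\<exists>(P::nat set) m (pi::'a \<Rightarrow> nat) lam. finite P \<and> median_algebra P m \<and>
      median_rank_le P m n \<and> pi ` A \<subseteq> P \<and>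
      (\<forall>x\<in>P. \<forall>y\<in>P. \<forall>z\<in>P. close (lam (m x y z)) (H' p) (mu (lam x) (lam y) (lam z))) \<and>
      (\<forall>a\<in>A. close (lam (pi a)) (H' p) a)"
    if A: "finite A" "1 \<le> card A" "card A \<le> p" for p and A :: "'a set"
  proof -
    obtain P :: "nat set" and m and pi :: "'a \<Rightarrow> nat" and lam where
      fin: "finite P" and med: "median_algebra P m" and pi: "pi ` A \<subseteq> P"
      and lam: "\<forall>x\<in>P. \<forall>y\<in>P. \<forall>z\<in>P. close (lam (m x y z)) (H p) (mu (lam x) (lam y) (lam z))"
      and lampi: "\<forall>a\<in>A. close (lam (pi a)) (H p) a"
      using C2 A unfolding cm_C2_def by (metis option.case(1))
    interpret finite_median_alg P m
      using fin med by unfold_locales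
    define Q where "Q = generated m (pi ` A)"
    have "card (pi ` A) \<le> p"
      using card_image_le[OF A(1), of pi] A(3) by simp
    then have "(2::nat) ^ 2 ^ card (pi ` A) \<le> 2 ^ 2 ^ p"
      by (intro power_increasing) auto
    then have "card Q < 2 ^ 2 ^ p + 1"
      using card_generated[OF pi] unfolding Q_def by linarith
    moreover have "finite_median_alg Q m"
      unfolding Q_def using pi by (rule finite_median_alg_generated)
    moreover have "approx_hom (H p) Q m lam"
      using lam generated_subset[OF pi] unfolding Q_def approx_hom_def close_def by blast
    moreover have "pi ` A \<subseteq> Q"
      unfolding Q_def by (auto intro: generated.base)
    ultimately obtain P' m' and pi' :: "'a \<Rightarrow> nat" where P':
      "finite_median_alg P' m'" "median_rank_le P' m' n"
      "approx_hom (H' p) P' m' lam" "pi' ` A \<subseteq> P'" "\<forall>a\<in>A. dist (lam (pi' a)) a \<le> H' p"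
      using H'(2)[of p, unfolded reduces_def, rule_format, of Q m lam pi A] lampi
      unfolding close_def by blast
    interpret Q: finite_median_alg P' m' by fact
    show ?thesis
      using P' Q.finite_P Q.median unfolding approx_hom_def close_def
      by (intro exI[of _ P'] exI[of _ m'] exI[of _ pi'] exI[of _ lam] conjI)
  qed
  then show ?thesis
    using H'(1) unfolding cm_C2_def by (intro exI[of _ H']) auto
qed

end

theorem theorem4p11:
  fixes mu :: "'a::metric_space \<Rightarrow> 'a \<Rightarrow> 'a \<Rightarrow> 'a" and n :: nat
  assumes "coarse_median mu"
  shows "(coarse_median_rank_le mu n \<longleftrightarrow>
           (\<forall>lambda>0. \<exists>C. \<forall>a b (e::nat \<Rightarrow> 'a).
              (\<forall>i<n+1. e i \<in> cm_interval mu a b) \<and>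
              (\<forall>i<n+1. \<forall>j<n+1. i \<noteq> j \<longrightarrow> close (mu (e i) a (e j)) lambda a)
              \<longrightarrow> (\<exists>i<n+1. close (e i) C a)))
       \<and> (coarse_median_rank_le mu n \<longleftrightarrow>
           (\<forall>L>0. \<exists>C. \<forall>sg. quasi_morphism mu L (n+1) sg \<longrightarrow>
              (\<exists>x y. cube_adjacent (n+1) x y \<and> close (sg x) C (sg y))))"
proof -
  obtain K H0 H where C1: "cm_C1 mu K H0" and C2: "cm_C2 mu H None"
    and mu: "\<And>a b. mu a a b = a" "\<And>a b c. mu a b c = mu b a c" "\<And>a b c. mu a b c = mu a c b"
    using assms unfolding coarse_median_def by blast
  \<comment> \<open>\<open>cm_C1\<close> allows a negative \<open>K\<close>; enlarging it to
    \<open>max K 0\<close> preserves the bound.\<close>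
  interpret coarse_median_space mu "max K 0" H0
  proof
    show "cm_C1 mu (max K 0) H0"
      unfolding cm_C1_def
    proof (intro allI)
      fix a b c a' b' c'
      have "dist (mu a b c) (mu a' b' c') \<le> K * (dist a a' + dist b b' + dist c c') + H0"
        using C1 by (simp add: cm_C1_def)
      also have "\<dots> \<le> max K 0 * (dist a a' + dist b b' + dist c c') + H0"
        by (intro add_right_mono mult_right_mono) auto
      finally show "dist (mu a b c) (mu a' b' c') \<le>
          max K 0 * (dist a a' + dist b b' + dist c c') + H0" .
    qed
  qed (use mu in auto)
  let ?disjoint = "\<forall>lambda>0. \<exists>C. \<forall>a b (e::nat \<Rightarrow> 'a).
      (\<forall>i<n+1. e i \<in> cm_interval mu a b) \<and>
      (\<forall>i<n+1. \<forall>j<n+1. i \<noteq> j \<longrightarrow> close (mu (e i) a (e j)) lambda a)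
      \<longrightarrow> (\<exists>i<n+1. close (e i) C a)"
  let ?cubes = "\<forall>L>0. \<exists>C. \<forall>sg. quasi_morphism mu L (n+1) sg \<longrightarrow>
      (\<exists>x y. cube_adjacent (n+1) x y \<and> close (sg x) C (sg y))"
  have "?disjoint" if rank: "coarse_median_rank_le mu n"
  proof -
    obtain H' where "cm_C2 mu H' (Some n)"
      using rank unfolding coarse_median_rank_le_def by blast
    then show ?thesis
      using disjoint_bound_of_rank by blast
  qed
  moreover have "?cubes" if "?disjoint"
    using cube_bound_of_disjoint_bound[OF that] by blast
  moreover have "coarse_median_rank_le mu n" if "?cubes"
    using C2_rank_of_cube_bound[OF that C2] assms C1 unfolding coarse_median_rank_le_def by blast
  ultimately show ?thesis
    by argo
qed

end
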